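(* For every integer $k\ge 1$, there exists an inversion-free proper $(2k+1)$-mixed-thin graph $G$ such that the twin-width of $G$ is at least $k$.
   Context: Graphs are finite and simple. **Inversion-free proper $k$-mixed-thin.** Let $G=(V,E)$ be a graph, $k>0$ an integer, and $\bar E=\binom{V}{2}\setminus E$. $G$ is *inversion-free proper $k$-mixed-thin* if there exist a partition $(V_1,\ldots,V_k)$ of $V$ and, for each $1\le i\le j\le k$, a linear order $\le_{ij}$ on $V_i\cup V_j$ and a choice of $E_{i,j}\in\{E,\bar E\}$ such that for every $1\le i\le j\le k$ (writing $\lneq_{ij}$ for the strict order): (a') the restriction of $\le_{ij}$ to $V_i$ (resp. to $V_j$) is equal to $\le_{ii}$ (resp. $\le_{jj}$); (b) for every triple $u,v,w$ such that ($\{u,v\}\subseteq V_i$ and $w\in V_j$) or ($\{u,v\}\subseteq V_j$ and $w\in V_i$): if $u\lneq_{ij}v\lneq_{ij}w$ and $uw\in E_{i,j}$, then $vw\in E_{i,j}$; (c) for every triple $u,v,w$ such that ($\{v,w\}\subseteq V_i$ and $u\in V_j$) or ($\{v,w\}\subseteq V_j$ and $u\in V_i$): if $u\lneq_{ij}v\lneq_{ij}w$ and $uw\in E_{i,j}$, then $uv\in E_{i,j}$. **Twin-width.** Consider square matrices with entries in $\{0,1,r\}$, rows and columns indexed by the same set; $r$ is the *red* entry. The *red number* of a matrix is the maximum number of red entries over all its rows and columns. *Contraction* of rows (resp. columns) $p$ and $q$ gives the matrix obtained by deleting $q$ and replacing entries of $p$ by $r$ whenever they differ from the corresponding entries of $q$.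 A *contraction sequence* of a matrix goes from the matrix down to a $1\times 1$ matrix by successive contractions. It is *symmetric* if every contraction of a pair of rows (resp. columns) is immediately followed by the contraction of the corresponding pair of columns (resp. rows). The *symmetric twin-width* of a matrix is the minimum $d$ such that it has a symmetric contraction sequence in which every matrix has red number at most $d$, where the red number is counted only after both the row contraction and the corresponding column contraction are performed. The *twin-width* of a graph $G$ is the symmetric twin-width of its adjacency matrix (red entries on the main diagonal are counted). *)

theory Defs
  imports Main "HOL-Library.Disjoint_Sets"
begin

section \<open>Graphs and inversion-free proper mixed-thinness\<close>

definition all_pairs :: "'a set \<Rightarrow> 'a set set" where
  "all_pairs V = {e. e \<subseteq> V \<and> card e = 2}"

definition simple_graph :: "'a set \<Rightarrow> 'a set set \<Rightarrow> bool" where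
  "simple_graph V E \<longleftrightarrow> finite V \<and> E \<subseteq> all_pairs V"

definition strictly_below :: "'a rel \<Rightarrow> 'a \<Rightarrow> 'a \<Rightarrow> bool" where
  "strictly_below r u v \<longleftrightarrow> (u, v) \<in> r \<and> u \<noteq> v"

text \<open>
  The parts are \<open>P 1, \<dots>, P k\<close>, and they are nonempty. For \<open>1 \<le> i \<le> j \<le> k\<close>, \<open>L i j\<close> is the (reflexive)
  linear order on \<open>P i \<union> P j\<close> and \<open>F i j\<close> is the chosen set among \<open>E\<close> and its complement; the values
  of \<open>P\<close>, \<open>L\<close> and \<open>F\<close> at other indices are irrelevant.
\<close>

definition inversion_free_proper_mixed_thin :: "nat \<Rightarrow> 'a set \<Rightarrow> 'a set set \<Rightarrow> bool" where
  "inversion_free_proper_mixed_thin k V E \<longleftrightarrow> k > 0 \<and>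
     (\<exists>(P :: nat \<Rightarrow> 'a set) (L :: nat \<Rightarrow> nat \<Rightarrow> 'a rel) (F :: nat \<Rightarrow> nat \<Rightarrow> 'a set set).
        partition_on V (P ` {1..k}) \<and> inj_on P {1..k} \<and>
        (\<forall>i j. 1 \<le> i \<and> i \<le> j \<and> j \<le> k \<longrightarrow>
           linear_order_on (P i \<union> P j) (L i j) \<and>
           F i j \<in> {E, all_pairs V - E} \<and>
           Restr (L i j) (P i) = L i i \<and>
           Restr (L i j) (P j) = L j j \<and>
           (\<forall>u v w.
              ({u, v} \<subseteq> P i \<and> w \<in> P j) \<or> ({u, v} \<subseteq> P j \<and> w \<in> P i) \<longrightarrow>
              strictly_below (L i j) u v \<and> strictly_below (L i j) v w \<and> {u, w} \<in> F i j \<longrightarrow>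
              {v, w} \<in> F i j) \<and>
           (\<forall>u v w.
              ({v, w} \<subseteq> P i \<and> u \<in> P j) \<or> ({v, w} \<subseteq> P j \<and> u \<in> P i) \<longrightarrow>
              strictly_below (L i j) u v \<and> strictly_below (L i j) v w \<and> {u, w} \<in> F i j \<longrightarrow>
              {u, v} \<in> F i j)))"


section \<open>Contraction sequences and twin-width\<close>

datatype entry = Zero | One | Red

text \<open>
  The row and column index sets are kept separately, because they differ after a row contraction
  that has not yet been followed by the corresponding column contraction. Entries outside
  \<open>row_set \<times> col_set\<close> play no role.
\<close>

record 'a red_matrix =
  row_set :: "'a set"
  col_set :: "'a set"
  ent :: "'a \<Rightarrow> 'a \<Rightarrow> entry"

definition red_number :: "'a red_matrix \<Rightarrow> nat" where
  "red_number M = Max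
     ((\<lambda>x. card {y \<in> col_set M. ent M x y = Red}) ` row_set M \<union>
      (\<lambda>y. card {x \<in> row_set M. ent M x y = Red}) ` col_set M)"

definition contract_rows :: "'a \<Rightarrow> 'a \<Rightarrow> 'a red_matrix \<Rightarrow> 'a red_matrix" where
  "contract_rows p q M = M\<lparr>
     row_set := row_set M - {q},
     ent := (\<lambda>x y. if x = p \<and> ent M p y \<noteq> ent M q y then Red else ent M x y)\<rparr>"

definition contract_cols :: "'a \<Rightarrow> 'a \<Rightarrow> 'a red_matrix \<Rightarrow> 'a red_matrix" where
  "contract_cols p q M = M\<lparr>
     col_set := col_set M - {q},
     ent := (\<lambda>x y. if y = p \<and> ent M x p \<noteq> ent M x q then Red else ent M x y)\<rparr>"

definition row_contraction :: "'a \<Rightarrow> 'a \<Rightarrow> 'a red_matrix \<Rightarrow> 'a red_matrix \<Rightarrow> bool" where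
  "row_contraction p q M M' \<longleftrightarrow>
     p \<in> row_set M \<and> q \<in> row_set M \<and> p \<noteq> q \<and> M' = contract_rows p q M"

definition col_contraction :: "'a \<Rightarrow> 'a \<Rightarrow> 'a red_matrix \<Rightarrow> 'a red_matrix \<Rightarrow> bool" where
  "col_contraction p q M M' \<longleftrightarrow>
     p \<in> col_set M \<and> q \<in> col_set M \<and> p \<noteq> q \<and> M' = contract_cols p q M"

definition contraction_sequence :: "'a red_matrix \<Rightarrow> 'a red_matrix list \<Rightarrow> bool" where
  "contraction_sequence M Ms \<longleftrightarrow>
     Ms \<noteq> [] \<and> hd Ms = M \<and> card (row_set (last Ms)) = 1 \<and> card (col_set (last Ms)) = 1 \<and>
     (\<forall>i. Suc i < length Ms \<longrightarrow>
        (\<exists>p q. row_contraction p q (Ms ! i) (Ms ! Suc i) \<or>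
               col_contraction p q (Ms ! i) (Ms ! Suc i)))"

text \<open>
  In a symmetric contraction sequence the contractions come in consecutive row/column pairs (in
  either order). Hence the matrices at even positions are exactly those at which both
  contractions of a pair are complete, and only these count towards the width.
\<close>

definition symmetric_contraction_sequence :: "'a red_matrix \<Rightarrow> 'a red_matrix list \<Rightarrow> bool" where
  "symmetric_contraction_sequence M Ms \<longleftrightarrow>
     contraction_sequence M Ms \<and> odd (length Ms) \<and>
     (\<forall>i. even i \<and> i + 2 < length Ms \<longrightarrow>
        (\<exists>p q.
           row_contraction p q (Ms ! i) (Ms ! (i + 1)) \<and>
           col_contraction p q (Ms ! (i + 1)) (Ms ! (i + 2)) \<or>
           col_contraction p q (Ms ! i) (Ms ! (i + 1)) \<and>
           row_contraction p q (Ms ! (i + 1)) (Ms ! (i + 2))))"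

text \<open>
  The minimum is over a nonempty set when \<open>M\<close> is a nonempty finite square matrix; for the empty
  matrix, which has no contraction sequence, the value is unspecified.
\<close>

definition symmetric_twin_width :: "'a red_matrix \<Rightarrow> nat" where
  "symmetric_twin_width M = (LEAST d. \<exists>Ms. symmetric_contraction_sequence M Ms \<and>
     (\<forall>i < length Ms. even i \<longrightarrow> red_number (Ms ! i) \<le> d))"

definition adjacency_matrix :: "'a set \<Rightarrow> 'a set set \<Rightarrow> 'a red_matrix" where
  "adjacency_matrix V E =
     \<lparr>row_set = V, col_set = V, ent = (\<lambda>u v. if {u, v} \<in> E then One else Zero)\<rparr>"

definition twin_width :: "'a set \<Rightarrow> 'a set set \<Rightarrow> nat" where
  "twin_width V E = symmetric_twin_width (adjacency_matrix V E)"

end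

theory Submission
  imports Defs
begin

text \<open>
  The rook's graph on an \<open>N \<times> N\<close> board, \<open>N = 2 * k + 1\<close>, with the board columns as parts, has
  the required properties. Reading the board row by row gives a single order that works for all
  pairs of parts: two columns are joined by a matching of consecutive vertices, and the complement
  is empty inside a column. Any two squares \<open>p\<close> and \<open>q\<close> are distinguished by at least
  \<open>N - 2 \<ge> k\<close> other squares, so already the first symmetric contraction creates \<open>k\<close> red entries.
\<close>

section \<open>Symmetric twin-width: existence of sequences and a lower bound from the first
  contraction\<close>

text \<open>Prepending two matrices shifts indices by two, so parity, and with it the pairing of row
  and column contractions, is preserved.\<close>

lemma symmetric_contraction_sequence_Cons:
  assumes "row_contraction p q M M'" "col_contraction p q M' M''"
    and Ms: "symmetric_contraction_sequence M'' Ms"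
  shows "symmetric_contraction_sequence M (M # M' # Ms)"
proof -
  have ne: "Ms \<noteq> []" and hd: "Ms ! 0 = M''"
    using Ms by (auto simp: symmetric_contraction_sequence_def contraction_sequence_def hd_conv_nth)
  have "\<exists>p q. row_contraction p q ((M # M' # Ms) ! i) ((M # M' # Ms) ! Suc i) \<or>
              col_contraction p q ((M # M' # Ms) ! i) ((M # M' # Ms) ! Suc i)"
    if "Suc i < length (M # M' # Ms)" for i
  proof -
    \<comment> \<open>Index 1 is the seam: its successor is the head of \<open>Ms\<close>, which is
      \<open>M''\<close>. From index 2 on, the property is inherited from \<open>Ms\<close>.\<close>
    consider "i = 0" | "i = 1" | j where "i = Suc (Suc j)"
      by (metis One_nat_def not0_implies_Suc)
    then show ?thesis
      by cases (use assms that hd in \<open>auto simp: symmetric_contraction_sequence_def contraction_sequence_def\<close>)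
  qed
  moreover have "\<exists>p q.
           row_contraction p q ((M # M' # Ms) ! i) ((M # M' # Ms) ! (i + 1)) \<and>
           col_contraction p q ((M # M' # Ms) ! (i + 1)) ((M # M' # Ms) ! (i + 2)) \<or>
           col_contraction p q ((M # M' # Ms) ! i) ((M # M' # Ms) ! (i + 1)) \<and>
           row_contraction p q ((M # M' # Ms) ! (i + 1)) ((M # M' # Ms) ! (i + 2))"
    if "even i" "i + 2 < length (M # M' # Ms)" for i
  proof -
    consider "i = 0" | j where "i = Suc (Suc j)" "even j"
      using \<open>even i\<close> by (metis even_Suc not0_implies_Suc even_zero)
    then show ?thesis
      by cases (use assms that hd in \<open>auto simp: symmetric_contraction_sequence_def\<close>)
  qed
  ultimately show ?thesis
    using Ms ne by (auto simp: symmetric_contraction_sequence_def contraction_sequence_def)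
qed

text \<open>A \<open>LEAST\<close> has no provable value until some \<open>d\<close> is known to
  qualify, so a sequence has to be exhibited. Contracting any two distinct indices, rows then
  columns, leaves a smaller matrix with equal row and column sets.\<close>

lemma symmetric_contraction_sequence_exists:
  assumes "finite (row_set M)" "row_set M \<noteq> {}" "col_set M = row_set M"
  shows "\<exists>Ms. symmetric_contraction_sequence M Ms"
  using assms
proof (induction "card (row_set M)" arbitrary: M rule: less_induct)
  case less
  show ?case
  proof (cases "card (row_set M) = 1")
    case True
    then have "symmetric_contraction_sequence M [M]"
      using less.prems by (simp add: symmetric_contraction_sequence_def contraction_sequence_def)
    then show ?thesis ..
  next
    case False
    obtain p where p: "p \<in> row_set M"
      using less.prems by blast
    obtain q where q: "q \<in> row_set M" "p \<noteq> q"
      using False p by (metis is_singletonI' is_singleton_altdef empty_iff)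
    let ?M' = "contract_rows p q M"
    let ?M'' = "contract_cols p q ?M'"
    have sets: "row_set ?M'' = row_set M - {q}" "col_set ?M'' = row_set M - {q}"
      using less.prems by (simp_all add: contract_rows_def contract_cols_def)
    have "card (row_set ?M'') < card (row_set M)"
      unfolding sets by (rule card_Diff1_less) (use less.prems q in auto)
    then obtain Ms where "symmetric_contraction_sequence ?M'' Ms"
      using less.hyps[of ?M''] less.prems p q sets by auto
    moreover have "row_contraction p q M ?M'" "col_contraction p q ?M' ?M''"
      using p q less.prems by (auto simp: row_contraction_def col_contraction_def contract_rows_def)
    ultimately show ?thesis
      by (intro exI[of _ "M # ?M' # Ms"] symmetric_contraction_sequence_Cons)
  qed
qed

text \<open>Turns the \<open>LEAST\<close> into an optimal sequence, which the lower bound can then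
  inspect.\<close>

lemma symmetric_twin_width_attained:
  assumes "finite (row_set M)" "row_set M \<noteq> {}" "col_set M = row_set M"
  obtains Ms where "symmetric_contraction_sequence M Ms"
    "\<And>i. i < length Ms \<Longrightarrow> even i \<Longrightarrow> red_number (Ms ! i) \<le> symmetric_twin_width M"
proof -
  let ?P = "\<lambda>d. \<exists>Ms. symmetric_contraction_sequence M Ms \<and>
     (\<forall>i < length Ms. even i \<longrightarrow> red_number (Ms ! i) \<le> d)"
  obtain Ms where Ms: "symmetric_contraction_sequence M Ms"
    using symmetric_contraction_sequence_exists[OF assms] by blast
  \<comment> \<open>The sum is just a convenient common upper bound, showing that some
    \<open>d\<close> satisfies \<open>?P\<close>.\<close>
  have "red_number (Ms ! i) \<le> (\<Sum>i<length Ms. red_number (Ms ! i))" if "i < length Ms" for i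
    using that by (intro member_le_sum) auto
  with Ms have "?P (\<Sum>i<length Ms. red_number (Ms ! i))"
    by blast
  then have "?P (symmetric_twin_width M)"
    unfolding symmetric_twin_width_def by (rule LeastI)
  with that show thesis by blast
qed

lemma red_number_ge_row:
  assumes "finite (row_set M)" "finite (col_set M)" "x \<in> row_set M"
  shows "card {y \<in> col_set M. ent M x y = Red} \<le> red_number M"
  unfolding red_number_def using assms by (intro Max_ge) auto

text \<open>The first symmetric contraction merges some \<open>p\<close> and \<open>q\<close>. In
  row \<open>p\<close>, each column \<open>y\<close> outside \<open>{p, q}\<close> where the two
  rows differ turns red. The column contraction alters only column \<open>p\<close> and deletes only
  column \<open>q\<close>, so these entries survive in either order of the two contractions.\<close>

lemma symmetric_twin_width_ge:
  assumes fin: "finite (row_set M)" and two: "card (row_set M) \<ge> 2" and sq: "col_set M = row_set M"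
    and diff: "\<And>p q. p \<in> row_set M \<Longrightarrow> q \<in> row_set M \<Longrightarrow> p \<noteq> q \<Longrightarrow>
           d \<le> card {y \<in> row_set M - {p, q}. ent M p y \<noteq> ent M q y}"
  shows "d \<le> symmetric_twin_width M"
proof -
  have ne: "row_set M \<noteq> {}" using two by auto
  obtain Ms where Ms: "symmetric_contraction_sequence M Ms"
    and le: "\<And>i. i < length Ms \<Longrightarrow> even i \<Longrightarrow> red_number (Ms ! i) \<le> symmetric_twin_width M"
    using symmetric_twin_width_attained[OF fin ne sq] by blast
  have M0: "Ms ! 0 = M" and "Ms \<noteq> []" and "card (row_set (last Ms)) = 1" and "odd (length Ms)"
    using Ms by (auto simp: symmetric_contraction_sequence_def contraction_sequence_def hd_conv_nth)
  \<comment> \<open>The last matrix has one row and \<open>M\<close> at least two; with odd length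
    this yields position 2, the first one after \<open>M\<close> whose red number counts.\<close>
  have "length Ms \<noteq> 1"
  proof
    assume "length Ms = 1"
    then have "last Ms = M"
      using M0 \<open>Ms \<noteq> []\<close> by (simp add: last_conv_nth)
    then show False
      using \<open>card (row_set (last Ms)) = 1\<close> two by simp
  qed
  then have len: "2 < length Ms"
    using \<open>odd (length Ms)\<close> by presburger
  then have "\<exists>p q. row_contraction p q (Ms ! 0) (Ms ! 1) \<and> col_contraction p q (Ms ! 1) (Ms ! 2) \<or>
      col_contraction p q (Ms ! 0) (Ms ! 1) \<and> row_contraction p q (Ms ! 1) (Ms ! 2)"
    using Ms by (force simp: symmetric_contraction_sequence_def numeral_2_eq_2)
  then obtain p q where "row_contraction p q M (Ms ! 1) \<and> col_contraction p q (Ms ! 1) (Ms ! 2) \<or>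
      col_contraction p q M (Ms ! 1) \<and> row_contraction p q (Ms ! 1) (Ms ! 2)"
    unfolding M0 by blast
  then have pq: "p \<in> row_set M" "q \<in> row_set M" "p \<noteq> q"
    and sets: "row_set (Ms ! 2) = row_set M - {q}" "col_set (Ms ! 2) = row_set M - {q}"
    and red: "\<And>y. y \<noteq> p \<Longrightarrow> ent M p y \<noteq> ent M q y \<Longrightarrow> ent (Ms ! 2) p y = Red"
    using sq by (auto simp: row_contraction_def col_contraction_def contract_rows_def contract_cols_def)
  have "d \<le> card {y \<in> row_set M - {p, q}. ent M p y \<noteq> ent M q y}"
    using diff pq by blast
  also have "\<dots> \<le> card {y \<in> col_set (Ms ! 2). ent (Ms ! 2) p y = Red}"
    using fin red by (intro card_mono) (auto simp: sets)
  also have "\<dots> \<le> red_number (Ms ! 2)"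
    using pq fin by (intro red_number_ge_row) (auto simp: sets)
  also have "\<dots> \<le> symmetric_twin_width M"
    using le len by simp
  finally show ?thesis .
qed

corollary twin_width_ge:
  assumes "finite V" "card V \<ge> 2"
    and "\<And>p q. p \<in> V \<Longrightarrow> q \<in> V \<Longrightarrow> p \<noteq> q \<Longrightarrow>
           d \<le> card {y \<in> V - {p, q}. ({p, y} \<in> E) \<noteq> ({q, y} \<in> E)}"
  shows "d \<le> twin_width V E"
  unfolding twin_width_def
proof (rule symmetric_twin_width_ge)
  fix p q
  assume "p \<in> row_set (adjacency_matrix V E)" "q \<in> row_set (adjacency_matrix V E)" "p \<noteq> q"
  then have "d \<le> card {y \<in> V - {p, q}. ({p, y} \<in> E) \<noteq> ({q, y} \<in> E)}"
    using assms(3) by (simp add: adjacency_matrix_def)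
  also have "{y \<in> V - {p, q}. ({p, y} \<in> E) \<noteq> ({q, y} \<in> E)} =
      {y \<in> row_set (adjacency_matrix V E) - {p, q}.
         ent (adjacency_matrix V E) p y \<noteq> ent (adjacency_matrix V E) q y}"
    by (auto simp: adjacency_matrix_def)
  finally show "d \<le> card \<dots>" .
qed (use assms(1,2) in \<open>simp_all add: adjacency_matrix_def\<close>)

section \<open>The rook's graph: separation of vertices and mixed-thinness\<close>

text \<open>The square in row \<open>r\<close> and column \<open>c\<close> of the board is encoded as \<open>r * N + c\<close>.\<close>

definition rook_vertices :: "nat \<Rightarrow> nat set" where
  "rook_vertices N = {..<N * N}"

definition rook_edges :: "nat \<Rightarrow> nat set set" where
  "rook_edges N = {{u, v} | u v. u \<in> rook_vertices N \<and> v \<in> rook_vertices N \<and> u \<noteq> v \<and>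
     (u div N = v div N \<or> u mod N = v mod N)}"

lemma rook_edge_iff:
  "{u, v} \<in> rook_edges N \<longleftrightarrow> u \<in> rook_vertices N \<and> v \<in> rook_vertices N \<and> u \<noteq> v \<and>
     (u div N = v div N \<or> u mod N = v mod N)"
  unfolding rook_edges_def by (auto simp: doubleton_eq_iff)

lemma simple_graph_rook: "simple_graph (rook_vertices N) (rook_edges N)"
  by (auto simp: simple_graph_def rook_vertices_def rook_edges_def all_pairs_def)

lemma square_in_rook_vertices:
  assumes "r < N" "c < N"
  shows "r * N + c \<in> rook_vertices N"
proof -
  have "r * N + c < (r + 1) * N" using assms by simp
  also have "\<dots> \<le> N * N" using assms by (intro mult_right_mono) auto
  finally show ?thesis by (simp add: rook_vertices_def)
qed

lemma div_mod_eqI: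
  fixes u v :: nat
  assumes "u div N = v div N" "u mod N = v mod N"
  shows "u = v"
  using assms by (metis div_mult_mod_eq)

text \<open>If \<open>p\<close> and \<open>q\<close> lie in different board columns, a square in the
  column of \<open>p\<close> that avoids the rows of both is adjacent to \<open>p\<close> but not to
  \<open>q\<close>. If they share a column, their rows differ and the row of \<open>p\<close> plays
  the same role.\<close>

lemma card_rook_distinguishing:
  assumes p: "p \<in> rook_vertices N" and q: "q \<in> rook_vertices N" and "p \<noteq> q"
  shows "N - 2 \<le> card {y \<in> rook_vertices N - {p, q}.
           ({p, y} \<in> rook_edges N) \<noteq> ({q, y} \<in> rook_edges N)}" (is "_ \<le> card ?D")
proof -
  have "N > 0" using p by (auto simp: rook_vertices_def intro: Nat.gr0I)
  have fin: "finite ?D" by (simp add: rook_vertices_def)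
  \<comment> \<open>The case \<open>a = b\<close> is allowed: the two squares may share a row or a
    column.\<close>
  have ge: "N - 2 \<le> card ({..<N} - {a, b})" for a b :: nat
  proof -
    have "card {..<N} - card {a, b} \<le> card ({..<N} - {a, b})"
      by (rule diff_card_le_card_Diff) simp
    moreover have "card {a, b} \<le> 2"
      by (simp add: card_insert_if)
    ultimately show ?thesis by simp
  qed
  show ?thesis
  proof (cases "p mod N = q mod N")
    case False
    let ?f = "\<lambda>x. x * N + p mod N"
    have in_D: "?f x \<in> ?D" if x: "x \<in> {..<N} - {p div N, q div N}" for x
    proof -
      have f: "?f x div N = x" "?f x mod N = p mod N" using \<open>N > 0\<close> by simp_all
      then have "?f x \<noteq> p" "?f x \<noteq> q" using x by fastforce+
      moreover have "?f x \<in> rook_vertices N"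
        using x \<open>N > 0\<close> by (intro square_in_rook_vertices) auto
      ultimately show ?thesis
        unfolding rook_edge_iff mem_Collect_eq f using p q False x by auto
    qed
    have "inj_on ?f ({..<N} - {p div N, q div N})"
      using \<open>N > 0\<close> by (auto simp: inj_on_def)
    moreover have "?f ` ({..<N} - {p div N, q div N}) \<subseteq> ?D"
      by (rule image_subsetI) (rule in_D)
    ultimately have "card ({..<N} - {p div N, q div N}) \<le> card ?D"
      using fin by (rule card_inj_on_le)
    with ge show ?thesis
      by (rule le_trans)
  next
    case True
    then have ne: "p div N \<noteq> q div N" using div_mod_eqI \<open>p \<noteq> q\<close> by blast
    have lt: "p div N < N" using p by (simp add: rook_vertices_def less_mult_imp_div_less)
    let ?f = "\<lambda>x. p div N * N + x"
    have in_D: "?f x \<in> ?D" if x: "x \<in> {..<N} - {p mod N, q mod N}" for x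
    proof -
      have f: "?f x div N = p div N" "?f x mod N = x" using x by simp_all
      then have "?f x \<noteq> p" "?f x \<noteq> q" using x by fastforce+
      moreover have "?f x \<in> rook_vertices N"
        using x lt by (intro square_in_rook_vertices) auto
      ultimately show ?thesis
        unfolding rook_edge_iff mem_Collect_eq f using p q ne x by auto
    qed
    have "inj_on ?f ({..<N} - {p mod N, q mod N})"
      by (auto simp: inj_on_def)
    moreover have "?f ` ({..<N} - {p mod N, q mod N}) \<subseteq> ?D"
      by (rule image_subsetI) (rule in_D)
    ultimately have "card ({..<N} - {p mod N, q mod N}) \<le> card ?D"
      using fin by (rule card_inj_on_le)
    with ge show ?thesis
      by (rule le_trans)
  qed
qed

text \<open>Conditions (b) and (c) hold vacuously: no vertex of the two parts lies strictly between
  the ends of a pair in \<open>F i j\<close>.\<close>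

lemma inversion_free_proper_mixed_thin_rook:
  assumes "N > 0"
  shows "inversion_free_proper_mixed_thin N (rook_vertices N) (rook_edges N)"
proof -
  let ?V = "rook_vertices N" and ?E = "rook_edges N"
  \<comment> \<open>\<open>Suc\<close> matches part indices starting at 1 with residues starting at
    0.\<close>
  define P where "P i = {v \<in> ?V. Suc (v mod N) = i}" for i
  \<comment> \<open>All orders are restrictions of \<open>\<le>\<close> on the codes, which reads
    the board row by row; this gives (a') at once.\<close>
  define L where "L i j = {(u, v). u \<in> P i \<union> P j \<and> v \<in> P i \<union> P j \<and> u \<le> v}" for i j
  define F where "F i j = (if i = j then all_pairs ?V - ?E else ?E)" for i j :: nat
  \<comment> \<open>The square in row 0 of board column \<open>i - 1\<close> shows that the part is
    nonempty, and its residue recovers \<open>i\<close>, hence injectivity of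
    \<open>P\<close>.\<close>
  have in_P: "i - 1 \<in> P i" if "i \<in> {1..N}" for i
    using that square_in_rook_vertices[of 0 N "i - 1"] by (auto simp: P_def)
  have part: "partition_on ?V (P ` {1..N})"
  proof (rule partition_onI)
    show "\<Union> (P ` {1..N}) = ?V"
      using \<open>N > 0\<close> by (auto simp: P_def Suc_le_eq)
    show "{} \<notin> P ` {1..N}"
      using in_P by blast
  qed (auto simp: P_def disjnt_def)
  have inj: "inj_on P {1..N}"
  proof (rule inj_onI)
    fix i j assume "i \<in> {1..N}" "P i = P j"
    with in_P have "i - 1 \<in> P i" "i - 1 \<in> P j" by auto
    then show "i = j" by (simp add: P_def)
  qed
  have lin: "linear_order_on (P i \<union> P j) (L i j)" for i j
    by (auto simp: linear_order_on_def partial_order_on_def preorder_on_def refl_on_def trans_def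
        antisym_def total_on_def L_def)
  have restr: "Restr (L i j) (P i) = L i i" "Restr (L i j) (P j) = L j j" for i j
    by (auto simp: L_def)
  have no_triple: False
    if ij: "u \<in> P i \<and> w \<in> P j \<or> u \<in> P j \<and> w \<in> P i" and v: "v \<in> P i \<union> P j"
      and "strictly_below (L i j) u v" "strictly_below (L i j) v w" and uw: "{u, w} \<in> F i j"
    for i j u v w
  proof -
    have lt: "u < v" "v < w"
      using that by (auto simp: strictly_below_def L_def)
    show False
    proof (cases "i = j")
      case True
      with ij lt have "{u, w} \<in> ?E" by (auto simp: P_def rook_edge_iff)
      with True uw show False by (simp add: F_def)
    next
      case False
      \<comment> \<open>Different parts are different board columns, so the edge runs inside a row.
        Rows are intervals of the order, so \<open>v\<close> is in that row too; sharing a column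
        with \<open>u\<close> or \<open>w\<close>, it would coincide with one of them.\<close>
      with ij uw have "u div N = w div N" by (auto simp: P_def F_def rook_edge_iff)
      then have "v div N = u div N" "v div N = w div N"
        using lt by (metis div_le_mono less_imp_le order_antisym)+
      moreover have "v mod N = u mod N \<or> v mod N = w mod N"
        using ij v by (auto simp: P_def)
      ultimately show False
        using lt div_mod_eqI by (metis less_irrefl)
    qed
  qed
  have choice: "F i j \<in> {?E, all_pairs ?V - ?E}" for i j
    by (simp add: F_def)
  show ?thesis
    unfolding inversion_free_proper_mixed_thin_def
  proof (intro conjI exI[of _ P] exI[of _ L] exI[of _ F] allI impI)
    fix i j u v w
    assume *: "strictly_below (L i j) u v \<and> strictly_below (L i j) v w \<and> {u, w} \<in> F i j"
    show "{v, w} \<in> F i j" if "{u, v} \<subseteq> P i \<and> w \<in> P j \<or> {u, v} \<subseteq> P j \<and> w \<in> P i"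
      using no_triple[of u i w j v] that * by blast
    show "{u, v} \<in> F i j" if "{v, w} \<subseteq> P i \<and> u \<in> P j \<or> {v, w} \<subseteq> P j \<and> u \<in> P i"
      using no_triple[of u i w j v] that * by blast
  qed (use \<open>N > 0\<close> part inj lin restr choice in simp_all)
qed

theorem proposition4p5:
  fixes k :: nat
  assumes "k \<ge> 1"
  shows "\<exists>(V :: nat set) (E :: nat set set).
           simple_graph V E \<and> inversion_free_proper_mixed_thin (2 * k + 1) V E \<and>
           twin_width V E \<ge> k"
proof -
  let ?N = "2 * k + 1"
  have "k \<le> twin_width (rook_vertices ?N) (rook_edges ?N)"
  proof (rule twin_width_ge)
    show "2 \<le> card (rook_vertices ?N)"
      using assms by (simp add: rook_vertices_def)
    show "k \<le> card {y \<in> rook_vertices ?N - {p, q}.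
            ({p, y} \<in> rook_edges ?N) \<noteq> ({q, y} \<in> rook_edges ?N)}"
      if "p \<in> rook_vertices ?N" "q \<in> rook_vertices ?N" "p \<noteq> q" for p q
      \<comment> \<open>Here \<open>N - 2\<close> is \<open>2 * k - 1\<close>, which is at least
        \<open>k\<close> because \<open>k \<ge> 1\<close>.\<close>
      using card_rook_distinguishing[OF that] assms by linarith
  qed (simp add: rook_vertices_def)
  moreover have "inversion_free_proper_mixed_thin ?N (rook_vertices ?N) (rook_edges ?N)"
    by (rule inversion_free_proper_mixed_thin_rook) simp
  ultimately show ?thesis
    using simple_graph_rook by blast
qed

end
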